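(* Let $\mathcal{S}$ be a finite linear space with $n$ points and let $G$ be its incidence graph. Then $$n\le h(G)\le n+\chi'(\mathcal{S}).$$ Moreover, if the Erdős–Faber–Lovász Conjecture is true for $\mathcal{S}$ (that is, if $\chi'(\mathcal{S})\le n$), then $h(G)\le 2n$.
   Context: A harmonious $k$-coloring of a finite simple graph $G$ is a proper vertex coloring with $k$ colors such that every (unordered) pair of colors appears on at most one edge. The harmonious chromatic number $h(G)$ is the minimum $k$ such that $G$ has a harmonious $k$-coloring. A linear space $\mathcal{S}$ is an incidence structure of points and lines such that: (1) any two distinct points determine a line (i.e. are incident to exactly one common line); (2) any line is incident to at least two distinct points; (3) there are at least two distinct lines. Its incidence graph is the bipartite graph whose vertices are the points and lines of $\mathcal{S}$, a point and a line being adjacent iff they are incident. The chromatic index $\chi'(\mathcal{S})$ is the smallest $k$ such that the lines of $\mathcal{S}$ can be colored with $k$ colors so that any two distinct intersecting lines (lines with a common point) receive different colors. *)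

theory Defs
  imports "Graph_Theory.Pair_Digraph"
begin

section \<open>Harmonious colorings\<close>

text \<open>
  Finite simple graphs are the \<^locale>\<open>pair_graph\<close>s of session \<open>Graph_Theory\<close>: an undirected edge is
  stored as the two arcs \<open>(u, v)\<close> and \<open>(v, u)\<close>. Since harmonious colorings count undirected
  edges, we identify the two arcs of an edge by passing to the set \<open>{u, v}\<close>.
\<close>

definition uedges :: "'a pair_pre_digraph \<Rightarrow> 'a set set" where
  "uedges G = {{u, v} | u v. (u, v) \<in> parcs G}"

definition proper_coloring :: "'a pair_pre_digraph \<Rightarrow> nat \<Rightarrow> ('a \<Rightarrow> nat) \<Rightarrow> bool" where
  "proper_coloring G k c \<longleftrightarrow>
     (\<forall>v \<in> pverts G. c v < k) \<and> (\<forall>u v. (u, v) \<in> parcs G \<longrightarrow> c u \<noteq> c v)"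

text \<open>
  For an edge \<open>e = {u, v}\<close>, the image \<open>c ` e\<close> is the unordered pair of colors appearing on \<open>e\<close>.
\<close>

definition harmonious_coloring :: "'a pair_pre_digraph \<Rightarrow> nat \<Rightarrow> ('a \<Rightarrow> nat) \<Rightarrow> bool" where
  "harmonious_coloring G k c \<longleftrightarrow>
     proper_coloring G k c \<and>
     (\<forall>e \<in> uedges G. \<forall>f \<in> uedges G. c ` e = c ` f \<longrightarrow> e = f)"

definition harmonious_chromatic_number :: "'a pair_pre_digraph \<Rightarrow> nat" where
  "harmonious_chromatic_number G = (LEAST k. \<exists>c. harmonious_coloring G k c)"

lemma (in pair_graph) ex_harmonious_coloring: "\<exists>k c. harmonious_coloring G k c"
proof -
  obtain c :: "'a \<Rightarrow> nat" and k where c: "c ` pverts G = {i. i < k}" "inj_on c (pverts G)"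
    using finite_imp_inj_to_nat_seg[OF pair_finite_verts] by blast
  have sub: "e \<subseteq> pverts G" if "e \<in> uedges G" for e
    using that by (auto simp: uedges_def dest: in_arcsD1 in_arcsD2)
  have "c u \<noteq> c v" if "(u, v) \<in> parcs G" for u v
    using that c(2) pair_no_loops[OF that] by (auto dest: in_arcsD1 in_arcsD2 inj_onD)
  moreover have "e = f" if "e \<in> uedges G" "f \<in> uedges G" "c ` e = c ` f" for e f
    using inj_on_image_eq_iff[OF c(2) sub sub] that by blast
  moreover have "c v < k" if "v \<in> pverts G" for v
    using c(1) that by blast
  ultimately have "harmonious_coloring G k c"
    unfolding harmonious_coloring_def proper_coloring_def by blast
  then show ?thesis by blast
qed

lemma (in pair_graph) harmonious_chromatic_number_attained:
  "\<exists>c. harmonious_coloring G (harmonious_chromatic_number G) c"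
  unfolding harmonious_chromatic_number_def using ex_harmonious_coloring by (rule LeastI_ex)


section \<open>Linear spaces\<close>

record ('p, 'l) pre_incidence_structure =
  points :: "'p set"
  lines :: "'l set"
  incident :: "('p \<times> 'l) set"

locale incidence_structure =
  fixes S :: "('p, 'l) pre_incidence_structure"
  assumes incident_wf: "incident S \<subseteq> points S \<times> lines S"

locale linear_space = incidence_structure +
  assumes unique_line:
    "\<lbrakk>p \<in> points S; q \<in> points S; p \<noteq> q\<rbrakk> \<Longrightarrow>
       \<exists>!l. l \<in> lines S \<and> (p, l) \<in> incident S \<and> (q, l) \<in> incident S"
  assumes two_points_on_line:
    "l \<in> lines S \<Longrightarrow>
       \<exists>p \<in> points S. \<exists>q \<in> points S. p \<noteq> q \<and> (p, l) \<in> incident S \<and> (q, l) \<in> incident S"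
  assumes two_lines: "\<exists>l \<in> lines S. \<exists>m \<in> lines S. l \<noteq> m"

definition intersecting ::
    "('p, 'l) pre_incidence_structure \<Rightarrow> 'l \<Rightarrow> 'l \<Rightarrow> bool" where
  "intersecting S l m \<longleftrightarrow> (\<exists>p \<in> points S. (p, l) \<in> incident S \<and> (p, m) \<in> incident S)"

definition line_coloring ::
    "('p, 'l) pre_incidence_structure \<Rightarrow> nat \<Rightarrow> ('l \<Rightarrow> nat) \<Rightarrow> bool" where
  "line_coloring S k c \<longleftrightarrow>
     (\<forall>l \<in> lines S. c l < k) \<and>
     (\<forall>l \<in> lines S. \<forall>m \<in> lines S. l \<noteq> m \<and> intersecting S l m \<longrightarrow> c l \<noteq> c m)"

definition chromatic_index :: "('p, 'l) pre_incidence_structure \<Rightarrow> nat" where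
  "chromatic_index S = (LEAST k. \<exists>c. line_coloring S k c)"

text \<open>The sum type keeps points and lines apart as vertices.\<close>

definition incidence_graph ::
    "('p, 'l) pre_incidence_structure \<Rightarrow> ('p + 'l) pair_pre_digraph" where
  "incidence_graph S =
     \<lparr> pverts = Inl ` points S \<union> Inr ` lines S,
       parcs = {(Inl p, Inr l) | p l. (p, l) \<in> incident S} \<union>
               {(Inr l, Inl p) | p l. (p, l) \<in> incident S} \<rparr>"

text \<open>
  A linear space with finitely many points has finitely many lines, so finiteness of the
  point set is the only finiteness assumption needed.
\<close>

lemma (in linear_space) finite_lines:
  assumes "finite (points S)"
  shows "finite (lines S)"
proof -
  define f where "f l = {p \<in> points S. (p, l) \<in> incident S}" for l
  have "inj_on f (lines S)"
  proof (rule inj_onI)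
    fix l m assume lm: "l \<in> lines S" "m \<in> lines S" "f l = f m"
    obtain p q where pq: "p \<in> points S" "q \<in> points S" "p \<noteq> q" "p \<in> f l" "q \<in> f l"
      using two_points_on_line[OF lm(1)] by (auto simp: f_def)
    then have "(p, l) \<in> incident S" "(q, l) \<in> incident S" "(p, m) \<in> incident S" "(q, m) \<in> incident S"
      using lm(3) by (auto simp: f_def)
    then show "l = m"
      using unique_line[OF pq(1-3)] lm(1,2) by blast
  qed
  moreover have "finite (f ` lines S)"
    by (rule finite_subset[of _ "Pow (points S)"]) (auto simp: f_def assms)
  ultimately show ?thesis by (metis finite_imageD)
qed

lemma (in linear_space) pair_graph_incidence_graph:
  assumes "finite (points S)"
  shows "pair_graph (incidence_graph S)"
proof -
  have "finite (pverts (incidence_graph S))"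
    using assms finite_lines[OF assms] by (simp add: incidence_graph_def)
  moreover have sub: "parcs (incidence_graph S) \<subseteq>
      pverts (incidence_graph S) \<times> pverts (incidence_graph S)"
    using incident_wf by (auto simp: incidence_graph_def)
  ultimately have "finite (parcs (incidence_graph S))"
    by (meson finite_SigmaI finite_subset)
  with \<open>finite (pverts (incidence_graph S))\<close> show ?thesis
    using incident_wf
    by unfold_locales (auto simp: incidence_graph_def symmetric_def intro!: symI)
qed

lemma (in linear_space) chromatic_index_attained:
  assumes "finite (points S)"
  shows "\<exists>c. line_coloring S (chromatic_index S) c"
proof -
  obtain c :: "'b \<Rightarrow> nat" and k where c: "c ` lines S = {i. i < k}" "inj_on c (lines S)"
    using finite_imp_inj_to_nat_seg[OF finite_lines[OF assms]] by blast
  then have "line_coloring S k c"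
    by (auto simp: line_coloring_def dest: inj_onD)
  then have "\<exists>k c. line_coloring S k c" by blast
  then show ?thesis
    unfolding chromatic_index_def by (rule LeastI_ex)
qed

end

theory Submission
  imports Defs
begin

text \<open>
  A harmonious coloring separates any two neighbours of a common vertex, because the two edges to
  that vertex would otherwise carry the same pair of colors. In the incidence graph of a linear
  space any two points are neighbours of the line joining them, so the points need \<open>n\<close> distinct
  colors.

  Conversely, give the points \<open>n\<close> distinct colors and color the lines from a disjoint palette by an
  optimal line coloring. Disjointness of the palettes means that the color pair of an edge tells
  which color belongs to the point and which to the line; the former determines the point \<open>p\<close>, and
  the latter then determines the line, since the lines through \<open>p\<close> intersect pairwise and hence have
  distinct colors.
\<close>

lemma uedges_incidence_graph:
  "uedges (incidence_graph S) = {{Inl p, Inr l} | p l. (p, l) \<in> incident S}"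
  unfolding uedges_def incidence_graph_def by (auto simp: insert_commute)

lemma harmonious_coloring_common_neighbour:
  assumes "harmonious_coloring G k c"
    and "(u, w) \<in> parcs G" "(v, w) \<in> parcs G" "c u = c v"
  shows "u = v"
proof -
  have "{u, w} \<in> uedges G" "{v, w} \<in> uedges G"
    using assms(2,3) by (auto simp: uedges_def)
  moreover have "c ` {u, w} = c ` {v, w}"
    using assms(4) by simp
  ultimately have "{u, w} = {v, w}"
    using assms(1) unfolding harmonious_coloring_def by blast
  then show ?thesis
    by (auto simp: doubleton_eq_iff)
qed

lemma harmonious_chromatic_number_le:
  "harmonious_coloring G k c \<Longrightarrow> harmonious_chromatic_number G \<le> k"
  unfolding harmonious_chromatic_number_def by (rule Least_le) blast

context linear_space
begin

lemma card_points_le_harmonious_coloring: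
  assumes "harmonious_coloring (incidence_graph S) k c"
  shows "card (points S) \<le> k"
proof -
  have "inj_on (\<lambda>p. c (Inl p)) (points S)"
  proof (rule inj_onI, rule ccontr)
    fix p q assume pq: "p \<in> points S" "q \<in> points S" "c (Inl p) = c (Inl q)" "p \<noteq> q"
    then obtain l where "(p, l) \<in> incident S" "(q, l) \<in> incident S"
      using unique_line by blast
    then have "(Inl p, Inr l) \<in> parcs (incidence_graph S)"
        "(Inl q, Inr l) \<in> parcs (incidence_graph S)"
      by (auto simp: incidence_graph_def)
    from harmonious_coloring_common_neighbour[OF assms this pq(3)] show False
      using pq(4) by simp
  qed
  moreover have "(\<lambda>p. c (Inl p)) ` points S \<subseteq> {..<k}"
    using assms
    by (auto simp: harmonious_coloring_def proper_coloring_def incidence_graph_def)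
  ultimately show ?thesis
    using card_inj_on_le[of _ "points S" "{..<k}"] by simp
qed

end

context incidence_structure
begin

text \<open>
  The point colors lie in \<open>{..<n}\<close>, so shifting the line colors by \<open>n\<close> makes the two palettes
  disjoint.
\<close>

lemma harmonious_coloring_incidence_graph:
  assumes "inj_on f (points S)" and "f ` points S \<subseteq> {..<n}"
    and "line_coloring S k g"
  shows "harmonious_coloring (incidence_graph S) (n + k) (case_sum f (\<lambda>l. n + g l))"
    (is "harmonious_coloring _ _ ?c")
proof -
  have wf: "p \<in> points S" "l \<in> lines S" if "(p, l) \<in> incident S" for p l
    using that incident_wf by auto
  have f_less: "f p < n" if "p \<in> points S" for p
    using that assms(2) by auto
  have g_less: "g l < k" if "l \<in> lines S" for l
    using that assms(3) by (simp add: line_coloring_def)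
  have "proper_coloring (incidence_graph S) (n + k) ?c"
    unfolding proper_coloring_def incidence_graph_def
    by (auto dest!: f_less wf(1) intro: g_less trans_less_add1)
  moreover have "e = e'"
    if "e \<in> uedges (incidence_graph S)" "e' \<in> uedges (incidence_graph S)" "?c ` e = ?c ` e'"
    for e e'
  proof -
    obtain p l q m where e: "e = {Inl p, Inr l}" "e' = {Inl q, Inr m}"
      and inc: "(p, l) \<in> incident S" "(q, m) \<in> incident S"
      using \<open>e \<in> _\<close> \<open>e' \<in> _\<close> by (auto simp: uedges_incidence_graph)
    have "{f p, n + g l} = {f q, n + g m}"
      using that(3) by (simp add: e)
    then have "f p = f q" "g l = g m"
      using f_less[OF wf(1)[OF inc(1)]] f_less[OF wf(1)[OF inc(2)]]
      by (auto simp: doubleton_eq_iff)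
    then have "p = q"
      using inj_onD[OF assms(1)] wf(1) inc by blast
    then have "intersecting S l m"
      using inc wf(1) by (auto simp: intersecting_def)
    then have "l = m"
      using assms(3) \<open>g l = g m\<close> wf(2) inc unfolding line_coloring_def by blast
    with \<open>p = q\<close> show ?thesis
      by (simp add: e)
  qed
  ultimately show ?thesis
    unfolding harmonious_coloring_def by blast
qed

end

theorem theorem10:
  fixes S :: "('p, 'l) pre_incidence_structure"
    and G :: "('p + 'l) pair_pre_digraph"
    and n :: nat
  assumes "linear_space S"
    and "finite (points S)"
    and "card (points S) = n"
    and "G = incidence_graph S"
  shows "n \<le> harmonious_chromatic_number G \<and>
         harmonious_chromatic_number G \<le> n + chromatic_index S \<and>
         (chromatic_index S \<le> n \<longrightarrow> harmonious_chromatic_number G \<le> 2 * n)"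
proof -
  interpret linear_space S
    by fact
  interpret pair_graph G
    unfolding assms(4) by (rule pair_graph_incidence_graph) fact
  have "n \<le> harmonious_chromatic_number G"
    using harmonious_chromatic_number_attained card_points_le_harmonious_coloring assms(3,4)
    by blast
  moreover have "harmonious_chromatic_number G \<le> n + chromatic_index S"
  proof -
    obtain f where "bij_betw f (points S) {0..<n}"
      using ex_bij_betw_finite_nat[OF assms(2)] assms(3) by blast
    then have f: "inj_on f (points S)" "f ` points S \<subseteq> {..<n}"
      by (auto simp: bij_betw_def)
    obtain g where "line_coloring S (chromatic_index S) g"
      using chromatic_index_attained[OF assms(2)] by blast
    from harmonious_coloring_incidence_graph[OF f this] show ?thesis
      unfolding assms(4) by (rule harmonious_chromatic_number_le)
  qed
  ultimately show ?thesis
    by simp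
qed

end
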